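(* Let $q=q(n)$ be any sequence of integers with $q(n)\ge 2$ for all $n$ and $q(n)\leq \frac{2}{\sqrt{e}}\,n-\omega(\log_2 n)$, i.e. $\left(\frac{2}{\sqrt e}n-q(n)\right)/\log_2 n\to\infty$ as $n\to\infty$. Then the probability that the uniformly random $n\times n$ jigsaw puzzle with $q(n)$ colors (with rotation of pieces allowed) has a unique vertex assembly or a unique edge assembly tends to $0$ as $n\to\infty$. That is, asymptotically almost surely the puzzle has neither a unique vertex assembly nor a unique edge assembly.
   Context: Random puzzle: the $n\times n$ board is cut into $n^2$ unit square cells. The resulting grid has $2n(n+1)$ unit edges (including those on the boundary of the board), and each of them is colored independently and uniformly at random with one of $q$ colors. The cell at each position, together with the colors of its four sides, is a jigsaw piece; thus two pieces that share a side have the same color on that side. Assemblies: the $n^2$ pieces are put unordered in a box, and their orientations are forgotten. Pieces may be rotated by multiples of $90^\circ$ but not flipped. A solution (valid assembly) is a placement of the $n^2$ pieces bijectively on the cells of the $n\times n$ board, together with a choice of one of the four orientations for each piece, such that whenever two pieces are placed in adjacent cells, the colors of their sides along the common edge coincide (there is no restriction along the boundary of the board). Each solution induces an edge coloring of the $2n(n+1)$ edges of the board. The puzzle has a unique vertex assembly if the position and orientation of every piece are the same in all solutions, up to rotation of the entire board by a multiple of $90^\circ$ (i.e. every solution is obtained from the original one by such a rotation of the whole puzzle). The puzzle has a unique edge assembly if the edge colorings induced by all solutions are the same up to rotation of the entire board by a multiple of $90^\circ$ (so solutions may differ by reshuffling identical pieces). *)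

theory Defs
  imports "HOL-Probability.Probability"
begin

text \<open>
  Cells are pairs (row, column), with rows numbered downwards from the top.
  \<open>H i j\<close> is the horizontal unit edge on top of cell \<open>(i, j)\<close>, and
  \<open>V i j\<close> is the vertical unit edge to the left of cell \<open>(i, j)\<close>.
\<close>

type_synonym cell = "nat \<times> nat"

datatype edge = H nat nat | V nat nat

definition cells :: "nat \<Rightarrow> cell set" where
  "cells n = {..<n} \<times> {..<n}"

definition edges :: "nat \<Rightarrow> edge set" where
  "edges n = {H i j | i j. i \<le> n \<and> j < n} \<union> {V i j | i j. i < n \<and> j \<le> n}"

text \<open>
  The sides of a cell are numbered clockwise from the top: 0 top, 1 right, 2 bottom, 3 left.
  Side numbers are only used below 4.
\<close>

fun side :: "cell \<Rightarrow> nat \<Rightarrow> edge" where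
  "side (i, j) d =
    (if d = 0 then H i j else if d = 1 then V i (j + 1)
     else if d = 2 then H (i + 1) j else V i j)"

definition random_puzzle :: "nat \<Rightarrow> nat \<Rightarrow> (edge \<Rightarrow> nat) pmf" where
  "random_puzzle n q = Pi_pmf (edges n) 0 (\<lambda>_. pmf_of_set {..<q})"

text \<open>
  A piece is identified with the cell \<open>p\<close> it was cut from; its side colors are
  \<open>c (side p k)\<close> for \<open>k < 4\<close>. An assembly puts piece \<open>p\<close> on the cell \<open>pos p\<close>, turned clockwise
  by \<open>rot p\<close> quarter turns, so that its side \<open>k\<close> lies on the edge \<open>placed_side pos rot p k\<close>
  of the board.
\<close>

definition placed_side :: "(cell \<Rightarrow> cell) \<Rightarrow> (cell \<Rightarrow> nat) \<Rightarrow> cell \<Rightarrow> nat \<Rightarrow> edge" where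
  "placed_side pos rot p k = side (pos p) ((k + rot p) mod 4)"

definition solution ::
    "nat \<Rightarrow> (edge \<Rightarrow> nat) \<Rightarrow> (cell \<Rightarrow> cell) \<Rightarrow> (cell \<Rightarrow> nat) \<Rightarrow> bool" where
  "solution n c pos rot \<longleftrightarrow>
     bij_betw pos (cells n) (cells n) \<and>
     (\<forall>p \<in> cells n. rot p < 4) \<and>
     (\<forall>p \<in> cells n. \<forall>p' \<in> cells n. \<forall>k < 4. \<forall>k' < 4.
        p \<noteq> p' \<and> placed_side pos rot p k = placed_side pos rot p' k' \<longrightarrow>
        c (side p k) = c (side p' k'))"

text \<open>For a solution, the color described below is unique for every \<open>e \<in> edges n\<close>.\<close>

definition induced_coloring ::
    "nat \<Rightarrow> (edge \<Rightarrow> nat) \<Rightarrow> (cell \<Rightarrow> cell) \<Rightarrow> (cell \<Rightarrow> nat) \<Rightarrow> edge \<Rightarrow> nat" where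
  "induced_coloring n c pos rot e =
     (THE x. \<exists>p \<in> cells n. \<exists>k < 4. placed_side pos rot p k = e \<and> x = c (side p k))"

text \<open>The clockwise quarter turn of the board, acting on cells and on edges.\<close>

fun turn_cell :: "nat \<Rightarrow> cell \<Rightarrow> cell" where
  "turn_cell n (i, j) = (j, n - 1 - i)"

fun turn_edge :: "nat \<Rightarrow> edge \<Rightarrow> edge" where
  "turn_edge n (H i j) = V j (n - i)"
| "turn_edge n (V i j) = H j (n - 1 - i)"

definition unique_vertex_assembly :: "nat \<Rightarrow> (edge \<Rightarrow> nat) \<Rightarrow> bool" where
  "unique_vertex_assembly n c \<longleftrightarrow>
     (\<forall>pos rot. solution n c pos rot \<longrightarrow>
        (\<exists>t < 4. \<forall>p \<in> cells n. pos p = (turn_cell n ^^ t) p \<and> rot p = t))"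

definition unique_edge_assembly :: "nat \<Rightarrow> (edge \<Rightarrow> nat) \<Rightarrow> bool" where
  "unique_edge_assembly n c \<longleftrightarrow>
     (\<forall>pos rot pos' rot'. solution n c pos rot \<and> solution n c pos' rot' \<longrightarrow>
        (\<exists>t < 4. \<forall>e \<in> edges n.
           induced_coloring n c pos' rot' ((turn_edge n ^^ t) e) =
           induced_coloring n c pos rot e))"

end

theory Submission
  imports Defs "HOL-Combinatorics.Permutations"
begin

text \<open>
  The proof is an entropy count. A uniquely assembled coloring is determined up to the four
  turns of the board by the multiset of its \<open>n\<^sup>2\<close> pieces modulo rotation, and there are
  \<open>N \<le> (q\<^sup>4 + 3 q\<^sup>2) / 4\<close> pieces modulo rotation. So at most
  \<open>4 (N + n\<^sup>2 - 1 choose n\<^sup>2)\<close> of the \<open>q\<close> to the power \<open>2 n\<^sup>2 + 2 n\<close> colorings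
  are uniquely assembled. By Stirling the binomial coefficient is at most
  \<open>e q\<^sup>2 / (4 n\<^sup>2) + e / q\<^sup>2 + O(1 / n\<^sup>2)\<close> to the power \<open>n\<^sup>2\<close> times \<open>q\<close> to the power
  \<open>2 n\<^sup>2\<close>, which for \<open>q \<le> 2 n / \<surd>e\<close> is at most a constant times the latter; the remaining
  factor from the \<open>2 n\<close> extra edges sends the probability to 0.
\<close>

section \<open>Turning the board\<close>

lemma mem_cells: "p \<in> cells n \<longleftrightarrow> fst p < n \<and> snd p < n"
  by (cases p) (auto simp: cells_def)

lemma H_mem_edges [simp]: "H i j \<in> edges n \<longleftrightarrow> i \<le> n \<and> j < n"
  by (auto simp: edges_def)

lemma V_mem_edges [simp]: "V i j \<in> edges n \<longleftrightarrow> i < n \<and> j \<le> n"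
  by (auto simp: edges_def)

lemma edges_eq: "edges n = case_prod H ` ({..n} \<times> {..<n}) \<union> case_prod V ` ({..<n} \<times> {..n})"
  by (force simp: edges_def)

lemma finite_edges: "finite (edges n)"
  by (simp add: edges_eq)

lemma card_edges: "card (edges n) = 2 * n * (n + 1)"
proof -
  have "inj_on (case_prod H) X" "inj_on (case_prod V) X" for X
    by (auto simp: inj_on_def)
  then show ?thesis
    unfolding edges_eq by (subst card_Un_disjoint) (auto simp: card_image)
qed

lemma finite_cells: "finite (cells n)"
  by (simp add: cells_def)

lemma card_cells: "card (cells n) = n\<^sup>2"
  by (simp add: cells_def power2_eq_square)

lemma side_in_edges: "p \<in> cells n \<Longrightarrow> side p k \<in> edges n"
  by (cases p) (auto simp: mem_cells)

lemma edge_is_side: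
  assumes "e \<in> edges n" "n > 0"
  obtains p k where "p \<in> cells n" "k < 4" "side p k = e"
proof (cases e)
  case (H i j)
  show ?thesis
  proof (cases "i < n")
    case True
    then show ?thesis using H assms that[of "(i, j)" 0] by (auto simp: mem_cells)
  next
    case False
    \<comment> \<open>On the bottom boundary \<open>i = n\<close>, so the edge is no top side but
      the bottom side of the last row.\<close>
    then show ?thesis using H assms that[of "(i - 1, j)" 2] by (auto simp: mem_cells)
  qed
next
  case (V i j)
  show ?thesis
  proof (cases "j < n")
    case True
    then show ?thesis using V assms that[of "(i, j)" 3] by (auto simp: mem_cells)
  next
    case False
    then show ?thesis using V assms that[of "(i, j - 1)" 1] by (auto simp: mem_cells)
  qed
qed

lemma turn_cell_in_cells: "p \<in> cells n \<Longrightarrow> turn_cell n p \<in> cells n"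
  by (cases p) (auto simp: mem_cells)

text \<open>A clockwise quarter turn carries side \<open>k\<close> of a cell to side
  \<open>k + 1\<close> of the turned cell, so \<open>turn_edge\<close> is the action on edges
  induced by \<open>turn_cell\<close>.\<close>

lemma side_turn_cell:
  assumes "p \<in> cells n" "k < 4"
  shows "side (turn_cell n p) (Suc k mod 4) = turn_edge n (side p k)"
proof -
  obtain i j where p: "p = (i, j)" by (cases p)
  have "k = 0 \<or> k = 1 \<or> k = 2 \<or> k = 3" using assms by auto
  then show ?thesis using assms by (auto simp: p mem_cells)
qed

lemma side_turn_cell_funpow:
  assumes "p \<in> cells n" "k < 4"
  shows "(turn_cell n ^^ t) p \<in> cells n \<and>
    side ((turn_cell n ^^ t) p) ((k + t) mod 4) = (turn_edge n ^^ t) (side p k)"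
proof (induction t)
  case 0
  then show ?case using assms by simp
next
  case (Suc t)
  have "side (turn_cell n ((turn_cell n ^^ t) p)) (Suc ((k + t) mod 4) mod 4) =
      turn_edge n (side ((turn_cell n ^^ t) p) ((k + t) mod 4))"
    by (rule side_turn_cell) (use Suc in auto)
  then show ?case using Suc by (simp add: turn_cell_in_cells mod_Suc_eq)
qed

lemma turn_edge_image: "turn_edge n ` edges n = edges n"
proof (rule endo_inj_surj[OF finite_edges])
  show "turn_edge n ` edges n \<subseteq> edges n"
  proof
    fix x assume "x \<in> turn_edge n ` edges n"
    then obtain e where "e \<in> edges n" "x = turn_edge n e" by blast
    then show "x \<in> edges n" by (cases e) auto
  qed
  show "inj_on (turn_edge n) (edges n)"
  proof (rule inj_onI)
    fix x y assume "x \<in> edges n" "y \<in> edges n" "turn_edge n x = turn_edge n y"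
    then show "x = y" by (cases x; cases y) auto
  qed
qed

lemma turn_edge_funpow_image: "(turn_edge n ^^ t) ` edges n = edges n"
proof (induction t)
  case (Suc t)
  have "(turn_edge n ^^ Suc t) ` edges n = turn_edge n ` (turn_edge n ^^ t) ` edges n"
    by (simp add: image_image)
  then show ?case unfolding Suc turn_edge_image .
qed simp

section \<open>Boxes of pieces\<close>

text \<open>The orbit under cyclic shifts. Side colors are listed clockwise, so for a list of length
  4 this is a piece whose orientation has been forgotten.\<close>

definition rotations :: "'a list \<Rightarrow> 'a list set" where
  "rotations l = (\<lambda>t. rotate t l) ` {..<4}"

definition piece :: "(edge \<Rightarrow> nat) \<Rightarrow> cell \<Rightarrow> nat list" where
  "piece c p = map (\<lambda>k. c (side p k)) [0..<4]"

definition piece_box :: "nat \<Rightarrow> (edge \<Rightarrow> nat) \<Rightarrow> nat list set multiset" where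
  "piece_box n c = image_mset (\<lambda>p. rotations (piece c p)) (mset_set (cells n))"

lemma length_piece [simp]: "length (piece c p) = 4"
  by (simp add: piece_def)

lemma nth_piece: "k < 4 \<Longrightarrow> piece c p ! k = c (side p k)"
  by (simp add: piece_def)

text \<open>Every edge is a side of some cell, hence covered by the piece placed there, and every
  color read off at \<open>e\<close> is \<open>c' e\<close>. The description in
  \<open>induced_coloring\<close> is therefore met by exactly one color.\<close>

lemma induced_coloring_eqI:
  assumes e: "e \<in> edges n" "n > 0" and bij: "bij_betw pos (cells n) (cells n)"
    and rot: "\<And>p. p \<in> cells n \<Longrightarrow> rot p < 4"
    and c: "\<And>p k. p \<in> cells n \<Longrightarrow> k < 4 \<Longrightarrow> c (side p k) = c' (placed_side pos rot p k)"
  shows "induced_coloring n c pos rot e = c' e"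
proof -
  obtain p' k' where p': "p' \<in> cells n" "k' < 4" "side p' k' = e"
    using edge_is_side[OF e] .
  have "p' \<in> pos ` cells n" using bij p'(1) by (simp add: bij_betw_def)
  then obtain p where p: "p \<in> cells n" "pos p = p'" by blast
  \<comment> \<open>The side of piece \<open>p\<close> that \<open>rot p\<close> quarter turns bring
    to \<open>k'\<close>; adding \<open>4 - rot p\<close> undoes the rotation within the natural
    numbers.\<close>
  define k where "k = (k' + (4 - rot p)) mod 4"
  have "(k + rot p) mod 4 = (k' + (4 - rot p) + rot p) mod 4"
    by (simp add: k_def mod_add_left_eq)
  also have "\<dots> = k'" using rot[OF p(1)] p' by simp
  finally have pl: "placed_side pos rot p k = e"
    using p p' by (simp add: placed_side_def)
  have "k < 4" by (simp add: k_def)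
  show ?thesis unfolding induced_coloring_def
  proof (rule the_equality)
    show "\<exists>p\<in>cells n. \<exists>k<4. placed_side pos rot p k = e \<and> c' e = c (side p k)"
      using p(1) \<open>k < 4\<close> pl c by metis
    show "x = c' e" if "\<exists>p\<in>cells n. \<exists>k<4. placed_side pos rot p k = e \<and> x = c (side p k)" for x
      using that c by auto
  qed
qed

lemma solution_id: "solution n c (\<lambda>p. p) (\<lambda>_. 0)"
  by (auto simp: solution_def placed_side_def bij_betw_def)

lemma rotations_eq_imp_rotated:
  assumes "rotations l = rotations l'" "length l = 4" "length l' = 4"
  obtains r where "r < 4" "\<And>k. k < 4 \<Longrightarrow> l ! k = l' ! ((k + r) mod 4)"
proof -
  have "l \<in> rotations l"
    by (auto simp: rotations_def intro!: image_eqI[where x = 0])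
  then obtain r where "r < 4" "l = rotate r l'"
    using assms(1) by (auto simp: rotations_def)
  then show thesis
    using that[of r] assms by (simp add: nth_rotate add.commute)
qed

text \<open>The pieces of \<open>c\<close> can be reassembled into the picture \<open>c'\<close>:
  equal multisets give a permutation matching the pieces, and equal orbits give the rotations. Sides
  meeting on an edge agree because both carry the color of \<open>c'\<close> there.\<close>

lemma box_eq_imp_solution:
  assumes "piece_box n c = piece_box n c'"
  obtains pos rot where "solution n c pos rot" "bij_betw pos (cells n) (cells n)"
    "\<And>p. p \<in> cells n \<Longrightarrow> rot p < 4"
    "\<And>p k. p \<in> cells n \<Longrightarrow> k < 4 \<Longrightarrow> c (side p k) = c' (placed_side pos rot p k)"
proof -
  obtain pos where pos: "pos permutes cells n"
    "\<forall>p\<in>cells n. rotations (piece c p) = rotations (piece c' (pos p))"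
    by (rule image_mset_eq_implies_permutes[OF finite_cells assms[unfolded piece_box_def]])
  have "\<exists>r<4. \<forall>k<4. piece c p ! k = piece c' (pos p) ! ((k + r) mod 4)" if "p \<in> cells n" for p
    using rotations_eq_imp_rotated[of "piece c p" "piece c' (pos p)"] pos(2) that
    by (metis length_piece)
  then obtain rot where rot: "\<And>p. p \<in> cells n \<Longrightarrow> rot p < 4"
    "\<And>p k. p \<in> cells n \<Longrightarrow> k < 4 \<Longrightarrow>
      piece c p ! k = piece c' (pos p) ! ((k + rot p) mod 4)"
    by metis
  have bij: "bij_betw pos (cells n) (cells n)"
    using pos(1) by (rule permutes_imp_bij)
  have c: "c (side p k) = c' (placed_side pos rot p k)" if "p \<in> cells n" "k < 4" for p k
    using rot(2)[OF that] that by (simp add: nth_piece placed_side_def)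
  have "solution n c pos rot"
    using bij rot(1) c by (auto simp: solution_def)
  then show thesis using that bij rot(1) c by blast
qed

text \<open>Uniqueness is applied to the solution that reassembles \<open>c\<close> into
  \<open>c'\<close>. In the vertex case it is a turn of the board, so the colors move along with the
  cells. In the edge case it is compared with the identity placement, which induces \<open>c\<close>
  itself.\<close>

lemma unique_assembly_imp_turned:
  assumes u: "unique_vertex_assembly n c \<or> unique_edge_assembly n c"
    and b: "piece_box n c = piece_box n c'" and "n > 0"
  shows "\<exists>t<4. \<forall>e\<in>edges n. c' ((turn_edge n ^^ t) e) = c e"
proof -
  obtain pos rot where s: "solution n c pos rot" "bij_betw pos (cells n) (cells n)"
    "\<And>p. p \<in> cells n \<Longrightarrow> rot p < 4"
    "\<And>p k. p \<in> cells n \<Longrightarrow> k < 4 \<Longrightarrow> c (side p k) = c' (placed_side pos rot p k)"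
    by (rule box_eq_imp_solution[OF b]) (rule that)
  from u show ?thesis
  proof
    assume "unique_vertex_assembly n c"
    then obtain t where t: "t < 4" "\<And>p. p \<in> cells n \<Longrightarrow> pos p = (turn_cell n ^^ t) p \<and> rot p = t"
      using s(1) unfolding unique_vertex_assembly_def by blast
    have "c' ((turn_edge n ^^ t) e) = c e" if e: "e \<in> edges n" for e
    proof -
      obtain p k where p: "p \<in> cells n" "k < 4" "side p k = e"
        using edge_is_side[OF e \<open>n > 0\<close>] .
      show ?thesis
        using s(4)[OF p(1,2)] side_turn_cell_funpow[OF p(1,2), of t] t(2)[OF p(1)] p(3)
        by (simp add: placed_side_def)
    qed
    then show ?thesis using t(1) by blast
  next
    assume "unique_edge_assembly n c"
    then obtain t where t: "t < 4" "\<And>e. e \<in> edges n \<Longrightarrow>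
        induced_coloring n c pos rot ((turn_edge n ^^ t) e) =
        induced_coloring n c (\<lambda>p. p) (\<lambda>_. 0) e"
      using s(1) solution_id unfolding unique_edge_assembly_def by meson
    have "c' ((turn_edge n ^^ t) e) = c e" if e: "e \<in> edges n" for e
    proof -
      have "(turn_edge n ^^ t) e \<in> edges n"
        using e turn_edge_funpow_image by blast
      then have "induced_coloring n c pos rot ((turn_edge n ^^ t) e) = c' ((turn_edge n ^^ t) e)"
        by (rule induced_coloring_eqI) (use \<open>n > 0\<close> s in auto)
      moreover have "induced_coloring n c (\<lambda>p. p) (\<lambda>_. 0) e = c e"
        by (rule induced_coloring_eqI[OF e \<open>n > 0\<close>]) (auto simp: placed_side_def bij_betw_def)
      ultimately show ?thesis using t(2)[OF e] by simp
    qed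
    then show ?thesis using t(1) by blast
  qed
qed

section \<open>Counting\<close>

text \<open>The value 0 off the board matches the default in \<open>random_puzzle\<close>, which for
  \<open>q > 0\<close> is the uniform distribution on this finite set.\<close>

definition colorings :: "nat \<Rightarrow> nat \<Rightarrow> (edge \<Rightarrow> nat) set" where
  "colorings n q = PiE_dflt (edges n) 0 (\<lambda>_. {..<q})"

definition words :: "nat \<Rightarrow> nat list set" where
  "words q = {l. set l \<subseteq> {..<q} \<and> length l = 4}"

lemma finite_colorings: "finite (colorings n q)"
  unfolding colorings_def by (intro finite_PiE_dflt) (auto simp: finite_edges)

lemma card_colorings: "card (colorings n q) = q ^ (2 * n * (n + 1))"
  unfolding colorings_def by (subst card_PiE_dflt) (auto simp: finite_edges card_edges)

lemma coloring_eq_zero: "c \<in> colorings n q \<Longrightarrow> e \<notin> edges n \<Longrightarrow> c e = 0"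
  by (auto simp: colorings_def PiE_dflt_def)

lemma finite_words: "finite (words q)"
  unfolding words_def by (rule finite_lists_length_eq) simp

lemma card_words: "card (words q) = q ^ 4"
  unfolding words_def by (subst card_lists_length_eq) auto

section \<open>Number of pieces modulo rotation\<close>

lemma words_iff:
  "l \<in> words q \<longleftrightarrow> (\<exists>x<q. \<exists>y<q. \<exists>z<q. \<exists>w<q. l = [x, y, z, w])"
  by (auto simp: words_def numeral_eq_Suc length_Suc_conv)

lemma rotate_2_list4: "rotate 2 [x, y, z, w] = [z, w, x, y]"
  by (simp add: numeral_eq_Suc)

lemma rotations_list4:
  "rotations [x, y, z, w] = {[x, y, z, w], [y, z, w, x], [z, w, x, y], [w, x, y, z]}"
proof -
  have four: "{..<4} = {0, 1, 2, 3 :: nat}" by auto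
  have "rotate 0 [x, y, z, w] = [x, y, z, w]" "rotate 1 [x, y, z, w] = [y, z, w, x]"
    "rotate 3 [x, y, z, w] = [w, x, y, z]"
    by (simp_all add: numeral_eq_Suc)
  then show ?thesis
    unfolding rotations_def four by (simp only: image_insert image_empty rotate_2_list4)
qed

text \<open>Every nontrivial subgroup of the cyclic group of order 4 contains the half turn, so a
  word not fixed by \<open>rotate 2\<close> has trivial stabilizer. The orbits of such words thus
  have four elements each, and they partition a subset of these words.\<close>

lemma card_asymmetric_rotations:
  "4 * card (rotations ` {l \<in> words q. rotate 2 l \<noteq> l}) \<le> card {l \<in> words q. rotate 2 l \<noteq> l}"
proof -
  let ?A = "{l \<in> words q. rotate 2 l \<noteq> l}"
  have fin: "finite ?A" using finite_words by simp
  have sub: "\<Union> (rotations ` ?A) \<subseteq> ?A"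
    by (auto simp: words_iff rotations_list4 rotate_2_list4)
  have "4 * card (rotations ` ?A) = card (\<Union> (rotations ` ?A))"
  proof (rule card_partition)
    show "finite (rotations ` ?A)" using fin by simp
    show "finite (\<Union> (rotations ` ?A))" using finite_subset[OF sub fin] .
    show "card X = 4" if X: "X \<in> rotations ` ?A" for X
    proof -
      obtain l where l: "l \<in> words q" "rotate 2 l \<noteq> l" "X = rotations l" using X by blast
      then obtain x y z w where xyzw: "l = [x, y, z, w]" by (auto simp only: words_iff)
      have "\<not> (x = z \<and> y = w)"
        using l(2) unfolding xyzw rotate_2_list4 by auto
      then have "distinct [[x, y, z, w], [y, z, w, x], [z, w, x, y], [w, x, y, z]]"
        by auto
      moreover have "X = {[x, y, z, w], [y, z, w, x], [z, w, x, y], [w, x, y, z]}"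
        unfolding l(3) xyzw rotations_list4 ..
      ultimately show ?thesis
        using distinct_card[of "[[x, y, z, w], [y, z, w, x], [z, w, x, y], [w, x, y, z]]"] by simp
    qed
    show "X \<inter> Y = {}" if "X \<in> rotations ` ?A" "Y \<in> rotations ` ?A" "X \<noteq> Y" for X Y
    proof (rule ccontr)
      have eq: "rotations l = rotations m" if "m \<in> words q" "l \<in> rotations m" for l m
        using that by (auto simp: words_iff rotations_list4)
      assume "X \<inter> Y \<noteq> {}"
      then obtain l where "l \<in> X" "l \<in> Y" by blast
      then have "rotations l = X" "rotations l = Y"
        using that(1,2) eq by blast+
      then show False using that(3) by simp
    qed
  qed
  then show ?thesis using card_mono[OF fin sub] by simp
qed

lemma card_symmetric_words: "card {l \<in> words q. rotate 2 l = l} = q\<^sup>2"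
proof -
  have "{l \<in> words q. rotate 2 l = l} = (\<lambda>(x, y). [x, y, x, y]) ` ({..<q} \<times> {..<q})"
  proof (intro equalityI subsetI)
    fix l assume l: "l \<in> {l \<in> words q. rotate 2 l = l}"
    then obtain x y z w where xyzw: "x < q" "y < q" "l = [x, y, z, w]"
      unfolding words_iff mem_Collect_eq by blast
    have "rotate 2 l = l" using l by blast
    then have "z = x \<and> w = y" unfolding xyzw(3) rotate_2_list4 by blast
    with xyzw show "l \<in> (\<lambda>(x, y). [x, y, x, y]) ` ({..<q} \<times> {..<q})"
      by (intro image_eqI[where x = "(x, y)"]) auto
  qed (auto simp: words_iff rotate_2_list4)
  moreover have "inj_on (\<lambda>(x, y). [x, y, x, y]) X" for X :: "(nat \<times> nat) set"
    by (auto simp: inj_on_def)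
  ultimately show ?thesis by (simp add: card_image power2_eq_square)
qed

text \<open>The \<open>q ^ 4 - q\<^sup>2\<close> asymmetric words give at most a quarter as many
  orbits; the \<open>q\<^sup>2\<close> symmetric words are counted crudely as one orbit
  each.\<close>

lemma card_rotations_words: "4 * card (rotations ` words q) \<le> q ^ 4 + 3 * q\<^sup>2"
proof -
  let ?A = "{l \<in> words q. rotate 2 l \<noteq> l}" and ?S = "{l \<in> words q. rotate 2 l = l}"
  have W: "words q = ?A \<union> ?S" by blast
  have "q ^ 4 = card ?A + card ?S"
    using card_Un_disjoint[of ?A ?S] finite_words by (subst card_words[symmetric], subst W) auto
  moreover have "card (rotations ` words q) \<le> card (rotations ` ?A) + card (rotations ` ?S)"
    by (subst W, subst image_Un) (rule card_Un_le)
  moreover have "card (rotations ` ?S) \<le> card ?S"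
    using finite_words by (intro card_image_le) auto
  ultimately show ?thesis
    using card_asymmetric_rotations[of q] card_symmetric_words[of q] by linarith
qed

section \<open>From boxes to the probability bound\<close>

lemma box_in_multisets:
  assumes "c \<in> colorings n q"
  shows "piece_box n c \<in> multisets_of_size (rotations ` words q) (n\<^sup>2)"
proof -
  have "piece c p \<in> words q" if "p \<in> cells n" for p
    using assms side_in_edges[OF that]
    by (auto simp: words_def piece_def colorings_def PiE_dflt_def)
  then show ?thesis
    by (auto simp: piece_box_def multisets_of_size_def finite_cells card_cells)
qed

text \<open>Colorings are grouped by their box. There are as many possible boxes as multisets of
  size \<open>n\<^sup>2\<close>, and each box comes from at most four uniquely assembled colorings,
  one for each turn of the board.\<close>

lemma card_unique_assembly_le:
  assumes "n > 0"
  shows "card {c \<in> colorings n q. unique_vertex_assembly n c \<or> unique_edge_assembly n c}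
    \<le> 4 * ((card (rotations ` words q) + n\<^sup>2 - 1) choose n\<^sup>2)"
proof -
  let ?U = "{c \<in> colorings n q. unique_vertex_assembly n c \<or> unique_edge_assembly n c}"
  let ?M = "multisets_of_size (rotations ` words q) (n\<^sup>2)"
  have finM: "finite ?M" using finite_words by (intro finite_multisets_of_size) auto
  have fiber: "card {c \<in> ?U. piece_box n c = B} \<le> 4" for B
  proof (cases "{c \<in> ?U. piece_box n c = B} = {}")
    case False
    define F where "F = {c \<in> ?U. piece_box n c = B}"
    obtain c where c: "c \<in> ?U" "piece_box n c = B" using False by blast
    have "\<forall>c'\<in>F. \<exists>t. t < 4 \<and> (\<forall>e\<in>edges n. c' ((turn_edge n ^^ t) e) = c e)"
    proof
      fix c' assume "c' \<in> F"
      then show "\<exists>t<4. \<forall>e\<in>edges n. c' ((turn_edge n ^^ t) e) = c e"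
        using c assms by (intro unique_assembly_imp_turned) (auto simp: F_def)
    qed
    from bchoice[OF this] obtain t where
      t: "\<And>c'. c' \<in> F \<Longrightarrow> t c' < 4"
        "\<And>c' e. c' \<in> F \<Longrightarrow> e \<in> edges n \<Longrightarrow> c' ((turn_edge n ^^ t c') e) = c e"
      by blast
    \<comment> \<open>The turn determines the coloring: every edge is the turn of some
      \<open>e'\<close>, where the color is forced to be \<open>c e'\<close>, and off the board the
      color is 0.\<close>
    have "inj_on t F"
    proof (rule inj_onI, rule ext)
      fix c1 c2 e
      assume *: "c1 \<in> F" "c2 \<in> F" "t c1 = t c2"
      show "c1 e = c2 e"
      proof (cases "e \<in> edges n")
        case True
        then obtain e' where e': "e' \<in> edges n" "e = (turn_edge n ^^ t c1) e'"
          using turn_edge_funpow_image[of "t c1" n] by blast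
        then show ?thesis using t(2)[OF *(1) e'(1)] t(2)[OF *(2) e'(1)] *(3) by simp
      next
        case False
        then show ?thesis using *(1,2) coloring_eq_zero[of c1 n q e] coloring_eq_zero[of c2 n q e]
          by (simp add: F_def)
      qed
    qed
    moreover have "t ` F \<subseteq> {..<4}" using t(1) by blast
    ultimately have "card F \<le> card {..<4 :: nat}" by (rule card_inj_on_le) simp
    then show ?thesis by (simp add: F_def)
  next
    case True
    show ?thesis unfolding True by simp
  qed
  have "?U = (\<Union>B\<in>?M. {c \<in> ?U. piece_box n c = B})"
    using box_in_multisets by blast
  then have "card ?U = card (\<Union>B\<in>?M. {c \<in> ?U. piece_box n c = B})"
    by (rule arg_cong)
  also have "\<dots> \<le> (\<Sum>B\<in>?M. card {c \<in> ?U. piece_box n c = B})"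
    by (rule card_UN_le[OF finM])
  also have "\<dots> \<le> (\<Sum>B\<in>?M. 4)"
    by (rule sum_mono) (rule fiber)
  also have "\<dots> = 4 * ((card (rotations ` words q) + n\<^sup>2 - 1) choose n\<^sup>2)"
    using finite_words by (simp add: card_multisets_of_size)
  finally show ?thesis .
qed

lemma prob_unique_assembly_le:
  assumes "n > 0" "q > 0"
  shows "measure_pmf.prob (random_puzzle n q)
      {c. unique_vertex_assembly n c \<or> unique_edge_assembly n c}
    \<le> 4 * real ((card (rotations ` words q) + n\<^sup>2 - 1) choose n\<^sup>2) / real q ^ (2 * n * (n + 1))"
proof -
  let ?E = "{c. unique_vertex_assembly n c \<or> unique_edge_assembly n c}"
  have "random_puzzle n q = pmf_of_set (colorings n q)"
    unfolding random_puzzle_def colorings_def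
    using assms by (intro Pi_pmf_of_set) (auto simp: finite_edges)
  moreover have "colorings n q \<noteq> {}"
    using card_colorings[of n q] assms by (metis card.empty power_not_zero less_irrefl)
  ultimately have "measure_pmf.prob (random_puzzle n q) ?E =
      real (card (colorings n q \<inter> ?E)) / real q ^ (2 * n * (n + 1))"
    by (simp add: measure_pmf_of_set finite_colorings card_colorings)
  also have "colorings n q \<inter> ?E = {c \<in> colorings n q. c \<in> ?E}" by blast
  also have "\<dots> = {c \<in> colorings n q. unique_vertex_assembly n c \<or> unique_edge_assembly n c}"
    by simp
  also have "real (card \<dots>) / real q ^ (2 * n * (n + 1)) \<le>
      real (4 * ((card (rotations ` words q) + n\<^sup>2 - 1) choose n\<^sup>2)) / real q ^ (2 * n * (n + 1))"
    using card_unique_assembly_le[OF assms(1), of q]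
    by (intro divide_right_mono of_nat_mono) auto
  finally show ?thesis by (simp only: of_nat_mult of_nat_numeral)
qed

section \<open>Asymptotics\<close>

text \<open>A single term of the exponential series. At \<open>x = m\<close> it gives the
  Stirling-type bound of \<open>m ^ m / fact m\<close> by \<open>exp m\<close>.\<close>

lemma power_div_fact_le_exp:
  fixes x :: real
  assumes "x \<ge> 0"
  shows "x ^ m / fact m \<le> exp x"
proof -
  have "(\<lambda>k. x ^ k / fact k) sums exp x"
    using exp_converges[of x] by (simp add: field_simps)
  from sum_le_suminf[OF sums_summable[OF this], of "{m}"] sums_unique[OF this] assms
  show ?thesis by simp
qed

lemma binomial_le_exp_power:
  assumes "m > 0"
  shows "real (N + m - 1 choose m) \<le> (exp 1 * (real N + real m) / real m) ^ m"
proof -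
  have "real (N + m - 1 choose m) * fact m \<le> real ((N + m - 1) ^ m)"
    using of_nat_mono[OF binomial_fact_pow[of "N + m - 1" m], where 'a = real]
    unfolding of_nat_mult of_nat_fact .
  also have "\<dots> \<le> (real N + real m) ^ m"
    unfolding of_nat_power by (rule power_mono) auto
  finally have "real (N + m - 1 choose m) \<le> (real N + real m) ^ m / fact m"
    by (simp add: field_simps)
  also have "\<dots> = ((real N + real m) / real m) ^ m * (real m ^ m / fact m)"
    using assms by (simp add: power_divide)
  also have "\<dots> \<le> ((real N + real m) / real m) ^ m * exp (real m)"
    by (intro mult_left_mono power_div_fact_le_exp) auto
  also have "\<dots> = (exp 1 * (real N + real m) / real m) ^ m"
    by (simp add: exp_of_nat_mult[of m 1, simplified] power_mult_distrib power_divide)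
  finally show ?thesis .
qed

text \<open>
  The left-hand side is \<open>e (N + m) / (m Q)\<close> with \<open>N = (Q\<^sup>2 + 3 Q) / 4\<close>. The term \<open>e / Q\<close> is of
  order \<open>1 / m\<close> only when \<open>Q\<close> is comparable to \<open>m\<close>; otherwise the first term leaves room for it.
\<close>

lemma exp_base_le:
  fixes m Q :: real
  assumes "m > 0" "Q \<ge> 9" "exp 1 * Q \<le> 4 * m"
  shows "exp 1 * (Q / 4 + 3 / 4) / m + exp 1 / Q \<le> 1 + 7 / m"
proof -
  have e: "exp 1 \<le> (3 :: real)" by (rule exp_le)
  have split: "exp 1 * (Q / 4 + 3 / 4) / m = exp 1 * Q / (4 * m) + (3 / 4) * exp 1 / m"
    by (simp add: distrib_left add_divide_distrib)
  have low: "(3 / 4) * exp 1 / m \<le> (9 / 4) / m"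
    using e assms by (intro divide_right_mono) auto
  show ?thesis
  proof (cases "exp 1 * Q \<le> 2 * m")
    case True
    \<comment> \<open>The two main terms sum to at most 1/2 + 1/3 < 1, leaving only the term of
      order \<open>1 / m\<close>.\<close>
    have "exp 1 * Q / (4 * m) \<le> 1 / 2"
      using True assms by (simp add: field_simps)
    moreover have "exp 1 / Q \<le> 3 / 9"
      using e assms by (intro frac_le) auto
    moreover have "(9 / 4) / m \<le> 7 / m"
      using assms by (intro divide_right_mono) auto
    ultimately show ?thesis using split low by linarith
  next
    case False
    have "exp 1 * Q / (4 * m) \<le> 1"
      using assms by (simp add: field_simps)
    moreover have "exp 1 / Q \<le> (9 / 2) / m"
    proof -
      \<comment> \<open>As \<open>2 * m < exp 1 * Q\<close>, the quotient \<open>exp 1 / Q\<close>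
        is at most e squared over \<open>2 * m\<close>, and e squared is at most 9. The constant 7
        is 9/4 + 9/2 = 27/4 rounded up.\<close>
      have "2 * m * exp 1 \<le> (exp 1 * Q) * exp 1"
        using False by (intro mult_right_mono) auto
      also have "\<dots> = (exp 1 * exp 1) * Q" by simp
      also have "\<dots> \<le> (3 * 3) * Q"
        using e assms by (intro mult_right_mono mult_mono) auto
      finally show ?thesis using assms by (simp add: field_simps)
    qed
    moreover have "(9 / 4) / m + (9 / 2) / m \<le> 7 / m"
      using assms by (simp add: field_simps)
    ultimately show ?thesis using split low by linarith
  qed
qed

text \<open>For \<open>q = 2\<close> the bound of \<open>exp_base_le\<close> is too weak, but the trivial one by \<open>2 ^ (N + m - 1)\<close>
  suffices.\<close>

lemma binomial_le_power:
  assumes "m > 0" "q \<ge> 2" "exp 1 * (real q)\<^sup>2 \<le> 4 * real m" "4 * N \<le> q ^ 4 + 3 * q\<^sup>2"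
  shows "real (N + m - 1 choose m) \<le> exp 7 * real q ^ (2 * m)"
proof (cases "q = 2")
  case True
  have "N + m - 1 choose m \<le> 2 ^ (N + m - 1)" by (rule binomial_le_pow2)
  \<comment> \<open>For \<open>q = 2\<close> the hypothesis reads \<open>4 * N \<le> 28\<close>, so
    \<open>N \<le> 7\<close>.\<close>
  also have "\<dots> \<le> 2 ^ (7 + 2 * m)"
    using assms(4) True by (intro power_increasing) auto
  finally have "real (N + m - 1 choose m) \<le> real (2 ^ (7 + 2 * m))"
    by (rule of_nat_mono)
  also have "\<dots> = 2 ^ 7 * 2 ^ (2 * m)" by (simp add: power_add)
  also have "\<dots> \<le> exp 1 ^ 7 * 2 ^ (2 * m)"
    using exp_ge_add_one_self[of 1] by (intro mult_right_mono power_mono) auto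
  also have "exp 1 ^ 7 = exp (7 :: real)"
    by (simp flip: exp_of_nat_mult)
  finally show ?thesis using True by simp
next
  case False
  let ?Q = "(real q)\<^sup>2"
  have "3\<^sup>2 \<le> ?Q" using False assms(2) by (intro power_mono) auto
  then have Q: "?Q \<ge> 9" by simp
  have "real (4 * N) \<le> real (q ^ 4 + 3 * q\<^sup>2)"
    using assms(4) by (simp only: of_nat_le_iff)
  then have N: "real N \<le> ?Q * (?Q / 4 + 3 / 4)"
    by (simp add: power2_eq_square power4_eq_xxxx algebra_simps)
  have "exp 1 * (real N + real m) / real m \<le> exp 1 * (?Q * (?Q / 4 + 3 / 4) + real m) / real m"
    using N by (intro divide_right_mono mult_left_mono) auto
  \<comment> \<open>The factor \<open>?Q\<close> yields \<open>q ^ (2 * m)\<close> after taking the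
    \<open>m\<close>-th power. The other factor is at most
    \<open>1 + 7 / m \<le> exp (7 / m)\<close>, whose \<open>m\<close>-th power stays below
    \<open>exp 7\<close>.\<close>
  also have "\<dots> = ?Q * (exp 1 * (?Q / 4 + 3 / 4) / real m + exp 1 / ?Q)"
    using assms(1,2) by (simp add: field_simps)
  also have "\<dots> \<le> ?Q * (1 + 7 / real m)"
    using exp_base_le[of "real m" ?Q] Q assms(1,3) by (intro mult_left_mono) auto
  also have "\<dots> \<le> ?Q * exp (7 / real m)"
    by (intro mult_left_mono exp_ge_add_one_self) auto
  finally have "exp 1 * (real N + real m) / real m \<le> ?Q * exp (7 / real m)" .
  then have "(exp 1 * (real N + real m) / real m) ^ m \<le> (?Q * exp (7 / real m)) ^ m"
    by (rule power_mono) simp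
  also have "\<dots> = exp 7 * real q ^ (2 * m)"
    using assms(1) by (simp add: power_mult_distrib power_mult flip: exp_of_nat_mult)
  finally show ?thesis
    using binomial_le_exp_power[OF assms(1), of N] by linarith
qed

theorem theorem1p1:
  fixes q :: "nat \<Rightarrow> nat"
  assumes "\<And>n. q n \<ge> 2"
    and "filterlim (\<lambda>n. (2 / sqrt (exp 1) * real n - real (q n)) / log 2 (real n))
           at_top sequentially"
  shows "(\<lambda>n. measure_pmf.prob (random_puzzle n (q n))
            {c. unique_vertex_assembly n c \<or> unique_edge_assembly n c}) \<longlonglongrightarrow> 0"
proof (rule tendsto_sandwich)
  let ?P = "\<lambda>n. measure_pmf.prob (random_puzzle n (q n))
            {c. unique_vertex_assembly n c \<or> unique_edge_assembly n c}"
  show "\<forall>\<^sub>F n in sequentially. 0 \<le> ?P n" by simp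
  have "\<forall>\<^sub>F n in sequentially.
      0 < (2 / sqrt (exp 1) * real n - real (q n)) / log 2 (real n)"
    using assms(2) by (simp add: filterlim_at_top_dense)
  \<comment> \<open>The 4 counts the turns, \<open>exp 7\<close> comes from
    \<open>binomial_le_power\<close>, and the power of 1/4 bounds \<open>q ^ (2 * n)\<close> in the
    denominator, left over from the \<open>2 * n\<close> surplus edges.\<close>
  then show "\<forall>\<^sub>F n in sequentially. ?P n \<le> 4 * exp 7 * (1 / 4) ^ n"
    using eventually_gt_at_top[of 1]
  proof eventually_elim
    case (elim n)
    \<comment> \<open>For \<open>n > 1\<close> the logarithm is positive, so positivity of the
      quotient passes to its numerator.\<close>
    have "real (q n) \<le> 2 / sqrt (exp 1) * real n"
      using elim by (auto simp: zero_less_divide_iff)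
    then have "(real (q n))\<^sup>2 \<le> (2 / sqrt (exp 1) * real n)\<^sup>2"
      by (rule power_mono) simp
    then have le: "exp 1 * (real (q n))\<^sup>2 \<le> 4 * real (n\<^sup>2)"
      by (simp add: power_mult_distrib power_divide field_simps)
    have q: "q n \<ge> 2" by (rule assms(1))
    have "?P n \<le> 4 * real ((card (rotations ` words (q n)) + n\<^sup>2 - 1) choose n\<^sup>2)
        / real (q n) ^ (2 * n * (n + 1))"
      by (rule prob_unique_assembly_le) (use q elim in auto)
    also have "\<dots> \<le> 4 * (exp 7 * real (q n) ^ (2 * n\<^sup>2)) / real (q n) ^ (2 * n * (n + 1))"
      using q elim card_rotations_words[of "q n"] le
      by (intro divide_right_mono mult_left_mono binomial_le_power) auto
    also have "2 * n * (n + 1) = 2 * n\<^sup>2 + 2 * n"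
      by (simp add: power2_eq_square)
    also have "4 * (exp 7 * real (q n) ^ (2 * n\<^sup>2)) / real (q n) ^ (2 * n\<^sup>2 + 2 * n) =
        4 * exp 7 * (1 / (real (q n))\<^sup>2) ^ n"
      using q by (simp add: power_add power_divide flip: power_mult)
    also have "\<dots> \<le> 4 * exp 7 * (1 / 4) ^ n"
    proof (intro mult_left_mono power_mono)
      have "2\<^sup>2 \<le> (real (q n))\<^sup>2" using q by (intro power_mono) auto
      then show "1 / (real (q n))\<^sup>2 \<le> 1 / 4" using q by (intro divide_left_mono) auto
    qed auto
    finally show ?case .
  qed
  show "(\<lambda>n. 4 * exp 7 * (1 / 4) ^ n :: real) \<longlonglongrightarrow> 0"
    by (intro tendsto_mult_right_zero LIMSEQ_power_zero) simp
qed simp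

end
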